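(* Let $\alpha > -1$ and $n \in \mathbb{N}$ be such that the Laguerre polynomials $L_{n+1}^{(\alpha+1)}(x)$ and $L_n^{(\alpha)}(x)$ have no common zeros. Let $z_1 < z_2 < \dots < z_{n+1}$ be the zeros of $L_{n+1}^{(\alpha+1)}(x)$ in increasing order. Then each of the $n+1$ intervals $(0,z_1), (z_1,z_2), \dots, (z_n,z_{n+1})$ contains either the point $n+1$ or exactly one (simple) zero of $L_n^{(\alpha)}(x)$, but not both. Moreover, the zeros of $L_n^{(\alpha)}(x)$ and $L_{n+1}^{(\alpha+1)}(x)$ are interlacing if and only if the smallest zero $z_1$ of $L_{n+1}^{(\alpha+1)}(x)$ satisfies $z_1 > n+1$.
   Context: $\mathbb{N}=\{1,2,3,\dots\}$. For $\alpha>-1$ and an integer $n\ge 0$, $L_n^{(\alpha)}(x)=\sum_{k=0}^{n}\binom{n+\alpha}{n-k}\frac{(-x)^k}{k!}$ is the Laguerre polynomial of degree $n$; the sequence $\{L_n^{(\alpha)}\}_{n\ge 0}$ is orthogonal on $(0,\infty)$ with respect to the weight $e^{-x}x^{\alpha}$, and $L_n^{(\alpha)}$ has $n$ real, simple, positive zeros. The zeros of two polynomials $p$ of degree $n$ and $q$ of degree $n+1$, each having only real simple zeros, are said to be interlacing if exactly one zero of $p$ lies strictly between each pair of successive zeros of $q$. *)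

theory Defs
  imports Complex_Main "HOL-Computational_Algebra.Polynomial"
begin

definition laguerre :: "real \<Rightarrow> nat \<Rightarrow> real poly" where
  "laguerre \<alpha> n =
     (\<Sum>k\<le>n. monom (((real n + \<alpha>) gchoose (n - k)) * (-1) ^ k / fact k) k)"

lemma poly_laguerre:
  "poly (laguerre \<alpha> n) x =
     (\<Sum>k=0..n. ((real n + \<alpha>) gchoose (n - k)) * ((- x) ^ k / fact k))"
proof -
  have "(- x) ^ k = (-1) ^ k * x ^ k" for k
    by (rule power_minus)
  then show ?thesis
    by (simp add: laguerre_def poly_sum poly_monom atMost_atLeast0 mult.assoc)
qed

definition zeros :: "real poly \<Rightarrow> real set" where
  "zeros p = {x. poly p x = 0}"

text \<open>Realness of the zeros is a claim about all complex zeros, hence the passage to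
  \<open>complex poly\<close>. The zero polynomial does not satisfy this predicate.\<close>
definition only_real_simple_zeros :: "real poly \<Rightarrow> bool" where
  "only_real_simple_zeros p \<longleftrightarrow>
     (\<forall>w::complex. poly (map_poly complex_of_real p) w = 0 \<longrightarrow>
        w \<in> \<real> \<and> order w (map_poly complex_of_real p) = 1)"

definition successive_zeros :: "real poly \<Rightarrow> real \<Rightarrow> real \<Rightarrow> bool" where
  "successive_zeros q a b \<longleftrightarrow>
     a \<in> zeros q \<and> b \<in> zeros q \<and> a < b \<and> zeros q \<inter> {a<..<b} = {}"

definition interlacing :: "real poly \<Rightarrow> real poly \<Rightarrow> bool" where
  "interlacing p q \<longleftrightarrow>
     degree q = degree p + 1 \<and> only_real_simple_zeros p \<and> only_real_simple_zeros q \<and>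
     (\<forall>a b. successive_zeros q a b \<longrightarrow> (\<exists>!x. x \<in> zeros p \<and> a < x \<and> x < b))"

end

theory Submission
  imports Defs
begin

text \<open>
  Write \<open>P\<close> and \<open>Q\<close> for the Laguerre polynomials of parameters \<open>\<alpha>\<close>, \<open>\<alpha> + 1\<close> and degrees
  \<open>n\<close>, \<open>N = n + 1\<close>. The relation
  \<open>a (a - 1) P = (x - N) (N Q - x Q') + a N Q\<close> with \<open>a = N + \<alpha> + 1\<close>
  shows that at the zeros \<open>0, z\<^sub>1, \<dots>, z\<^sub>N\<close> of \<open>R = x Q\<close> the sign of \<open>P\<close> is that of \<open>(N - x) R'\<close>.
  As \<open>R'\<close> alternates along the simple zeros of \<open>R\<close>, each of the \<open>n + 1\<close> gaps avoiding \<open>N\<close>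
  contains a zero of \<open>P\<close>. Since \<open>P\<close> has at most \<open>n\<close> zeros, \<open>N\<close> lies in one gap and every
  other gap contains exactly one zero; the zeros interlace iff the gap of \<open>N\<close> is the first.
\<close>

section \<open>Simple zeros by counting, and sign alternation of the derivative\<close>

text \<open>Every root has order at least 1 and the orders sum to at most the degree, so a single
  multiple root would make the sum too large.\<close>

lemma rsquarefree_if_card_roots_eq_degree:
  fixes p :: "'a::field_char_0 poly"
  assumes "p \<noteq> 0" and card: "card {x. poly p x = 0} = degree p"
  shows "rsquarefree p"
proof -
  have fin: "finite {x. poly p x = 0}"
    using \<open>p \<noteq> 0\<close> by (rule poly_roots_finite)
  have "order a p \<le> 1" for a
  proof (rule ccontr)
    assume gt: "\<not> order a p \<le> 1"
    then have a: "a \<in> {x. poly p x = 0}"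
      using \<open>p \<noteq> 0\<close> by (simp add: order_root)
    have "(\<Sum>x\<in>{x. poly p x = 0}. 1) < (\<Sum>x\<in>{x. poly p x = 0}. order x p)"
      using fin a gt \<open>p \<noteq> 0\<close>
      by (intro sum_strict_mono_ex1 bexI[of _ a]) (auto simp: order_root Suc_le_eq)
    also have "\<dots> \<le> degree p"
      using \<open>p \<noteq> 0\<close> by (rule sum_order_le_degree)
    finally show False
      using card by simp
  qed
  then show ?thesis
    using \<open>p \<noteq> 0\<close> by (auto simp: rsquarefree_def le_Suc_eq)
qed

text \<open>The embedded real zeros already number \<open>degree p\<close>, the bound for the
  complex zeros. They are therefore all of them, and the previous count over the complex numbers
  gives simplicity.\<close>

lemma only_real_simple_zeros_if_card_zeros_eq_degree:
  assumes "p \<noteq> 0" and card: "card (zeros p) = degree p"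
  shows "only_real_simple_zeros p"
proof -
  let ?c = "map_poly complex_of_real p"
  have deg: "degree ?c = degree p"
    by (simp add: degree_map_poly)
  have "?c \<noteq> 0"
    using \<open>p \<noteq> 0\<close> by (simp add: map_poly_eq_0_iff)
  have "poly ?c (complex_of_real x) = complex_of_real (poly p x)" for x
    by (induction p) (auto simp: map_poly_pCons)
  then have sub: "complex_of_real ` zeros p \<subseteq> {w. poly ?c w = 0}"
    by (auto simp: zeros_def)
  have card_image: "card (complex_of_real ` zeros p) = degree p"
    using card by (subst card_image) (auto simp: inj_on_def)
  have fin: "finite {w. poly ?c w = 0}"
    using \<open>?c \<noteq> 0\<close> by (rule poly_roots_finite)
  have eq: "complex_of_real ` zeros p = {w. poly ?c w = 0}"
    using card_poly_roots_bound[OF \<open>?c \<noteq> 0\<close>] card_image deg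
    by (intro card_seteq[OF fin sub]) simp
  have sqfree: "rsquarefree ?c"
    using \<open>?c \<noteq> 0\<close> card_image deg eq by (intro rsquarefree_if_card_roots_eq_degree) simp_all
  show ?thesis
    unfolding only_real_simple_zeros_def
  proof (intro allI impI conjI)
    fix w
    assume w: "poly ?c w = 0"
    then have "w \<in> complex_of_real ` zeros p"
      unfolding eq by simp
    then show "w \<in> \<real>"
      by auto
    show "order w ?c = 1"
      using sqfree w \<open>?c \<noteq> 0\<close> by (rule rsquarefree_root_order)
  qed
qed

text \<open>Write \<open>p = (x - a) (x - b) r\<close>. Then \<open>p'(a) = (a - b) r(a)\<close> and
  \<open>p'(b) = (b - a) r(b)\<close>, where \<open>r(a)\<close> and \<open>r(b)\<close> have the
  same sign: they are nonzero because the roots are simple, and a sign change of \<open>r\<close>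
  would produce a root of \<open>p\<close> in between.\<close>

lemma pderiv_mult_neg_at_consecutive_roots:
  fixes p :: "real poly"
  assumes p: "rsquarefree p" "poly p a = 0" "poly p b = 0"
    and "a < b" and no_root: "\<And>x. a < x \<Longrightarrow> x < b \<Longrightarrow> poly p x \<noteq> 0"
  shows "poly (pderiv p) a * poly (pderiv p) b < 0"
proof -
  obtain q where q: "p = [:-a, 1:] * q"
    using \<open>poly p a = 0\<close> by (auto simp: poly_eq_0_iff_dvd dvd_def)
  have "poly q b = 0"
    using \<open>poly p b = 0\<close> \<open>a < b\<close> by (simp add: q)
  then obtain r where r: "q = [:-b, 1:] * r"
    by (auto simp: poly_eq_0_iff_dvd dvd_def)
  have deriv: "poly (pderiv p) a = (a - b) * poly r a" "poly (pderiv p) b = (b - a) * poly r b"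
    unfolding q r by (simp_all add: pderiv_mult pderiv_pCons del: mult_pCons_left)
  have "poly r a \<noteq> 0" "poly r b \<noteq> 0"
    using p deriv by (auto simp: rsquarefree_roots)
  moreover have "\<not> poly r a * poly r b < 0"
    using poly_IVT[OF \<open>a < b\<close>, of r] no_root by (auto simp: q r)
  ultimately have "0 < poly r a * poly r b"
    by (simp add: linorder_not_less less_le)
  then have "0 < (b - a)\<^sup>2 * (poly r a * poly r b)"
    using \<open>a < b\<close> by (intro mult_pos_pos[of "(b - a)\<^sup>2"]) auto
  then show ?thesis
    by (simp add: deriv power2_eq_square algebra_simps)
qed

section \<open>Elementary properties of Laguerre polynomials\<close>

lemma coeff_laguerre:
  "coeff (laguerre \<alpha> n) k =
     (if k \<le> n then ((real n + \<alpha>) gchoose (n - k)) * (-1) ^ k / fact k else 0)"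
  by (simp add: laguerre_def coeff_sum if_distrib sum.delta cong: if_cong)

lemma degree_laguerre [simp]: "degree (laguerre \<alpha> n) = n"
  by (rule antisym[OF degree_le le_degree]) (auto simp: coeff_laguerre)

lemma laguerre_neq_0 [simp]: "laguerre \<alpha> n \<noteq> 0"
proof
  assume "laguerre \<alpha> n = 0"
  then have "coeff (laguerre \<alpha> n) n = 0"
    by simp
  then show False
    by (simp add: coeff_laguerre)
qed

lemma finite_zeros_laguerre: "finite (zeros (laguerre \<alpha> n))"
  unfolding zeros_def by (rule poly_roots_finite) simp

lemma card_zeros_laguerre_le: "card (zeros (laguerre \<alpha> n)) \<le> n"
  using card_poly_roots_bound[of "laguerre \<alpha> n"] by (simp add: zeros_def)

lemma poly_laguerre_pos:
  assumes "\<alpha> > -1" "x \<le> 0"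
  shows "poly (laguerre \<alpha> n) x > 0"
proof -
  \<comment> \<open>Each factor \<open>n + \<alpha> - i\<close> with \<open>i < n - k\<close> is at
    least \<open>\<alpha> + 1 > 0\<close>.\<close>
  have pos: "((real n + \<alpha>) gchoose (n - k)) > 0" for k
    using assms by (auto simp: gbinomial_prod_rev intro!: divide_pos_pos prod_pos)
  have "0 < (\<Sum>k\<in>{0}. ((real n + \<alpha>) gchoose (n - k)) * ((- x) ^ k / fact k))"
    using pos[of 0] by simp
  also have "\<dots> \<le> (\<Sum>k=0..n. ((real n + \<alpha>) gchoose (n - k)) * ((- x) ^ k / fact k))"
    using assms by (intro sum_mono2 mult_nonneg_nonneg divide_nonneg_nonneg zero_le_power
      less_imp_le[OF pos]) auto
  finally show ?thesis
    by (simp add: poly_laguerre)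
qed

section \<open>The relation between the two Laguerre polynomials\<close>

lemma gbinomial_double_absorption:
  fixes a :: "'a::field_char_0"
  shows "a * (a - 1) * (a - 2 gchoose j) = of_nat (Suc j) * (a - of_nat (Suc j)) * (a gchoose Suc j)"
proof -
  have "of_nat (Suc j) * (a - of_nat (Suc j)) * (a gchoose Suc j)
      = (a - 1 - of_nat j) * (of_nat (Suc j) * (a gchoose Suc j))"
    by (simp add: algebra_simps)
  also have "\<dots> = a * ((a - 1 - of_nat j) * (a - 1 gchoose j))"
    by (simp only: gbinomial_absorption mult_ac)
  also have "\<dots> = a * ((a - 1) * (a - 1 - 1 gchoose j))"
    by (simp only: gbinomial_absorb_comp)
  finally show ?thesis
    by (simp add: mult.assoc)
qed

text \<open>Comparing coefficients reduces the identity to double absorption. At a zero of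
  \<open>Q\<close> only the term with \<open>Q'\<close> survives, which ties the sign of the other
  polynomial to that of \<open>Q'\<close>.\<close>

lemma laguerre_mixed_relation:
  fixes \<beta> :: real and m :: nat
  defines "Q \<equiv> laguerre \<beta> (Suc m)" and "a \<equiv> real (Suc m) + \<beta>"
  shows "smult (a * (a - 1)) (laguerre (\<beta> - 1) m) =
    [:- real (Suc m), 1:] * (smult (real (Suc m)) Q - [:0, 1:] * pderiv Q) + smult (a * real (Suc m)) Q"
proof (rule poly_eqI)
  fix k
  let ?M = "real (Suc m)"
  let ?P = "laguerre (\<beta> - 1) m"
  have a_shift: "a - 2 = real m + (\<beta> - 1)"
    by (simp add: a_def)
  have Pk: "coeff ?P k = (a - 2 gchoose (m - k)) * (-1) ^ k / fact k" if "k \<le> m"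
    using that by (simp add: coeff_laguerre a_shift)
  have Qk: "coeff Q k = (a gchoose (Suc m - k)) * (-1) ^ k / fact k" if "k \<le> Suc m" for k
    using that by (simp add: Q_def coeff_laguerre a_def)
  have rhs: "coeff ([:- ?M, 1:] * (smult ?M Q - [:0, 1:] * pderiv Q) + smult (a * ?M) Q) k =
      (if k = 0 then 0 else (?M - real (k - 1)) * coeff Q (k - 1))
      + ?M * (a - ?M + real k) * coeff Q k"
    by (cases k) (auto simp: coeff_pCons coeff_pderiv algebra_simps split: nat.split)
  have "a * (a - 1) * coeff ?P k = (if k = 0 then 0 else (?M - real (k - 1)) * coeff Q (k - 1))
      + ?M * (a - ?M + real k) * coeff Q k"
  proof -
    consider "k \<le> m" | "k = Suc m" | "k > Suc m"
      by linarith
    then show ?thesis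
    proof cases
      case 1
      define j where "j = m - k"
      define s :: real where "s = (-1) ^ k / fact k"
      have Mk: "?M = real k + real (Suc j)" and Suc_j: "Suc m - k = Suc j"
        using 1 by (simp_all add: j_def Suc_diff_le)
      \<comment> \<open>Lowering the index from \<open>k\<close> to \<open>k - 1\<close> turns
        \<open>s\<close> into \<open>- k s\<close>; the factor \<open>k\<close> also absorbs the
        case \<open>k = 0\<close>.\<close>
      have 2: "(if k = 0 then 0 else (?M - real (k - 1)) * coeff Q (k - 1)) =
          - real k * (real (Suc (Suc j)) * (a gchoose Suc (Suc j))) * s"
      proof (cases k)
        case (Suc i)
        have "Suc m - i = Suc (Suc j)"
          using 1 Suc by (simp add: j_def)
        then have "coeff Q i = (a gchoose Suc (Suc j)) * (- real k * s)"
          using 1 Suc Qk[of i] by (simp add: s_def del: of_nat_Suc)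
        moreover have "?M - real i = real (Suc (Suc j))"
          using Mk Suc by simp
        ultimately show ?thesis
          using Suc by simp
      qed simp
      have 3: "real (Suc (Suc j)) * (a gchoose Suc (Suc j)) = (a - real (Suc j)) * (a gchoose Suc j)"
        using gbinomial_mult_1[of a "Suc j"] by (simp add: algebra_simps)
      have "a * (a - 1) * coeff ?P k = (a * (a - 1) * (a - 2 gchoose j)) * s"
        using 1 by (simp add: Pk j_def s_def)
      also have "\<dots> = real (Suc j) * (a - real (Suc j)) * (a gchoose Suc j) * s"
        by (simp only: gbinomial_double_absorption)
      \<comment> \<open>Since \<open>?M = k + (j + 1)\<close>, the factor \<open>j + 1\<close> is
        split as \<open>?M - k\<close>, and \<open>a - (j + 1)\<close> equals
        \<open>a - ?M + k\<close>.\<close>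
      also have "\<dots> = - real k * ((a - real (Suc j)) * (a gchoose Suc j)) * s
          + ?M * (a - ?M + real k) * ((a gchoose Suc j) * s)"
        unfolding Mk by (simp add: algebra_simps)
      also have "(a gchoose Suc j) * s = coeff Q k"
        using 1 by (simp add: Qk Suc_j s_def)
      finally show ?thesis
        unfolding 2 3 .
    next
      case 2
      define s :: real where "s = (-1) ^ k / fact k"
      have "fact k = ?M * fact m"
        using 2 by simp
      then have "coeff Q m = - a * ?M * s"
        using 2 by (simp add: Qk s_def del: of_nat_Suc)
      moreover have "coeff Q k = s"
        using 2 by (simp add: Qk s_def)
      moreover have "coeff ?P k = 0"
        using 2 by (simp add: coeff_laguerre)
      moreover have "?M - real m = 1"
        by simp
      ultimately show ?thesis
        using 2 by (simp del: of_nat_Suc)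
    next
      case 3
      then show ?thesis
        \<comment> \<open>For \<open>k = m + 2\<close> the leading coefficient of \<open>Q\<close>
          still occurs, but its factor \<open>?M - (k - 1)\<close> is 0.\<close>
        by (cases "k = Suc (Suc m)") (auto simp: Q_def coeff_laguerre)
    qed
  qed
  then show "coeff (smult (a * (a - 1)) ?P) k =
    coeff ([:- ?M, 1:] * (smult ?M Q - [:0, 1:] * pderiv Q) + smult (a * ?M) Q) k"
    unfolding rhs by simp
qed

theorem theorem2p1:
  fixes \<alpha> :: real and n :: nat and z :: "nat \<Rightarrow> real"
  assumes "\<alpha> > -1" and "n \<ge> 1"
    and "zeros (laguerre (\<alpha> + 1) (n + 1)) \<inter> zeros (laguerre \<alpha> n) = {}"
    and "strict_mono_on {1..n+1} z"
    and "z ` {1..n+1} = zeros (laguerre (\<alpha> + 1) (n + 1))"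
  shows "(\<forall>k\<in>{1..n+1}.
            let I = {(if k = 1 then 0 else z (k - 1))<..<z k} in
              (real (n + 1) \<in> I \<and> zeros (laguerre \<alpha> n) \<inter> I = {}) \<or>
              (real (n + 1) \<notin> I \<and>
                (\<exists>x. zeros (laguerre \<alpha> n) \<inter> I = {x} \<and> order x (laguerre \<alpha> n) = 1)))
       \<and> (interlacing (laguerre \<alpha> n) (laguerre (\<alpha> + 1) (n + 1)) \<longleftrightarrow> z 1 > real (n + 1))"
proof -

  \<comment> \<open>The zeros of R and the gaps between them\<close>
  define P Q N where "P = laguerre \<alpha> n" and "Q = laguerre (\<alpha> + 1) (n + 1)" and "N = real (n + 1)"
  \<comment> \<open>With \<open>y 0 = 0\<close>, the first interval has the same form as the others,
    and \<open>y 0, ..., y (n + 1)\<close> are exactly the zeros of \<open>R\<close>.\<close>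
  define y where "y k = (if k = 0 then 0 else z k)" for k
  define R where "R = [:0, 1:] * Q"
  define I where "I k = {y (k - 1)<..<y k}" for k
  have zeros_Q: "zeros Q = z ` {1..n+1}"
    using assms(5) by (simp add: Q_def)
  have inj_z: "inj_on z {1..n+1}"
    using assms(4) by (rule strict_mono_on_imp_inj_on)
  have Q_pos: "poly Q x > 0" if "x \<le> 0" for x
    using that assms(1) by (auto simp: Q_def intro!: poly_laguerre_pos)
  have z_pos: "z k > 0" if "k \<in> {1..n+1}" for k
  proof -
    have "poly Q (z k) = 0"
      using zeros_Q that by (auto simp: zeros_def)
    then show ?thesis
      using Q_pos[of "z k"] by (cases "z k \<le> 0") auto
  qed
  have y_less: "y i < y j" if "i < j" "j \<le> n + 1" for i j
    using that z_pos strict_mono_onD[OF assms(4), of i j] by (auto simp: y_def)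
  have y_less_iff: "y i < y j \<longleftrightarrow> i < j" if "i \<le> n + 1" "j \<le> n + 1" for i j
    using that y_less[of i j] y_less[of j i] by (cases i j rule: linorder_cases) auto
  have roots_R: "{x. poly R x = 0} = y ` {..n+1}"
  proof -
    have "{x. poly R x = 0} = insert 0 (zeros Q)"
      by (auto simp: R_def zeros_def)
    also have "\<dots> = y ` insert 0 {1..n+1}"
      by (auto simp: zeros_Q y_def)
    also have "insert 0 {1..n+1} = {..n+1}"
      by auto
    finally show ?thesis .
  qed
  have "inj_on y {..n+1}"
    by (intro inj_onI) (metis atMost_iff less_irrefl linorder_neqE_nat y_less_iff)
  then have card_R: "card {x. poly R x = 0} = n + 2"
    unfolding roots_R by (simp add: card_image)
  have "Q \<noteq> 0" "degree Q = n + 1"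
    by (simp_all add: Q_def)
  then have "R \<noteq> 0" "degree R = n + 2"
    by (simp_all add: R_def degree_mult_eq)
  then have R_sqfree: "rsquarefree R"
    using card_R by (intro rsquarefree_if_card_roots_eq_degree) simp_all
  have R_deriv: "poly (pderiv R) x = poly Q x + x * poly (pderiv Q) x" for x
    by (simp add: R_def pderiv_mult pderiv_pCons)

  \<comment> \<open>Signs of P at the zeros of R\<close>
  define a where "a = N + (\<alpha> + 1)"
  have a_pos: "a > N" "a > 1" "N > 0"
    using assms(1) by (auto simp: a_def N_def)
  have relation: "a * (a - 1) * poly P x =
      (x - N) * (N * poly Q x - x * poly (pderiv Q) x) + a * N * poly Q x" for x
    using arg_cong[OF laguerre_mixed_relation[of n "\<alpha> + 1"], of "\<lambda>p. poly p x"]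
    by (simp add: P_def Q_def N_def a_def algebra_simps)
  have P_at_y: "\<exists>c>0. c * poly P (y k) = (N - y k) * poly (pderiv R) (y k)" if "k \<le> n + 1" for k
  proof (cases "k = 0")
    case True
    \<comment> \<open>At 0 the relation reads \<open>a (a - 1) P(0) = (a - N) N Q(0)\<close>, and
      \<open>R'(0) = Q(0)\<close>; dividing by \<open>a - N > 0\<close> gives the constant.\<close>
    have "a * (a - 1) / (a - N) * poly P 0 = N * poly Q 0"
      using relation[of 0] a_pos by (simp add: field_simps)
    moreover have "a * (a - 1) / (a - N) > 0"
      using a_pos by simp
    ultimately show ?thesis
      using True by (intro exI[of _ "a * (a - 1) / (a - N)"]) (simp add: y_def R_deriv)
  next
    case False
    then have "poly Q (y k) = 0"
      using that zeros_Q by (auto simp: y_def zeros_def)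
    then have "a * (a - 1) * poly P (y k) = (N - y k) * poly (pderiv R) (y k)"
      using relation[of "y k"] by (simp add: R_deriv algebra_simps)
    then show ?thesis
      using a_pos by (intro exI[of _ "a * (a - 1)"]) simp
  qed
  have disjoint_zeros: "zeros P \<inter> zeros Q = {}"
    using assms(3) by (auto simp: P_def Q_def)
  \<comment> \<open>If \<open>N\<close> were a zero of \<open>Q\<close>, the factor
    \<open>N - y k\<close> would force \<open>P\<close> to vanish there too, against the absence of
    common zeros.\<close>
  have N_neq: "N \<noteq> y k" if "k \<le> n + 1" for k
  proof
    assume N: "N = y k"
    with a_pos have "k \<noteq> 0"
      by (cases "k = 0") (auto simp: y_def)
    then have "y k \<in> zeros Q"
      using that zeros_Q by (auto simp: y_def)
    moreover have "poly P (y k) = 0"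
      using P_at_y[OF that] N by auto
    ultimately show False
      using disjoint_zeros by (auto simp: zeros_def)
  qed
  have zero_in_I: "\<exists>x. x \<in> zeros P \<inter> I k" if k: "k \<in> {1..n+1}" "N \<notin> I k" for k
  proof -
    let ?u = "y (k - 1)" and ?v = "y k"
    have less: "?u < ?v"
      using k by (intro y_less) auto
    have "poly R x \<noteq> 0" if x: "?u < x" "x < ?v" for x
    proof
      assume "poly R x = 0"
      then have "x \<in> y ` {..n+1}"
        unfolding roots_R[symmetric] by simp
      then obtain i where "i \<le> n + 1" "x = y i"
        by auto
      then have "k - 1 < i" "i < k"
        using x k(1) y_less_iff[of "k - 1" i] y_less_iff[of i k] by auto
      then show False
        by linarith
    qed
    moreover have "?u \<in> {x. poly R x = 0}" "?v \<in> {x. poly R x = 0}"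
      unfolding roots_R using k(1) by auto
    then have "poly R ?u = 0" "poly R ?v = 0"
      by simp_all
    ultimately have R_neg: "poly (pderiv R) ?u * poly (pderiv R) ?v < 0"
      using R_sqfree less by (intro pderiv_mult_neg_at_consecutive_roots)
    have le: "k - 1 \<le> n + 1" "k \<le> n + 1"
      using k(1) by (simp_all add: le_diff_conv)
    obtain c where c: "c > 0" "c * poly P ?u = (N - ?u) * poly (pderiv R) ?u"
      using P_at_y[OF le(1)] by blast
    obtain d where d: "d > 0" "d * poly P ?v = (N - ?v) * poly (pderiv R) ?v"
      using P_at_y[OF le(2)] by blast
    \<comment> \<open>As \<open>N\<close> lies outside the closed gap, \<open>N - x\<close> has one
      sign at both ends while \<open>R'\<close> changes sign; hence \<open>P\<close> changes
      sign.\<close>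
    have "N < ?u \<or> ?v < N"
      using k(2) N_neq[OF le(1)] N_neq[OF le(2)] by (auto simp: I_def)
    then have "0 < (N - ?u) * (N - ?v)"
      using less by (auto simp: zero_less_mult_iff)
    then have "((N - ?u) * (N - ?v)) * (poly (pderiv R) ?u * poly (pderiv R) ?v) < 0"
      using R_neg by (rule mult_pos_neg)
    also have "((N - ?u) * (N - ?v)) * (poly (pderiv R) ?u * poly (pderiv R) ?v)
        = (c * poly P ?u) * (d * poly P ?v)"
      unfolding c(2) d(2) by (simp only: mult_ac)
    also have "\<dots> = (c * d) * (poly P ?u * poly P ?v)"
      by (simp add: algebra_simps)
    finally have "poly P ?u * poly P ?v < 0"
      using c(1) d(1) by (simp add: mult_less_0_iff zero_less_mult_iff)
    from poly_IVT[OF less this] show ?thesis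
      by (auto simp: zeros_def I_def)
  qed
  have I_disjoint: "i = j" if x: "x \<in> I i" "x \<in> I j" and ij: "i \<in> {1..n+1}" "j \<in> {1..n+1}" for x i j
  proof -
    have "y (i - 1) < y j" "y (j - 1) < y i"
      using x by (auto simp: I_def)
    then have "i - 1 < j" "j - 1 < i"
      using ij y_less_iff[of "i - 1" j] y_less_iff[of "j - 1" i] by auto
    then show ?thesis
      by linarith
  qed

  \<comment> \<open>Counting the zeros of P over the gaps\<close>
  define S where "S = {k \<in> {1..n+1}. N \<notin> I k}"
  obtain f where f: "\<And>k. k \<in> S \<Longrightarrow> f k \<in> zeros P \<inter> I k"
    using zero_in_I unfolding S_def by (metis (no_types, lifting) mem_Collect_eq)
  have inj_f: "inj_on f S"
    using f I_disjoint unfolding S_def by (intro inj_onI) (metis (no_types, lifting) IntE mem_Collect_eq)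
  have fin_P: "finite (zeros P)" and card_P: "card (zeros P) \<le> n"
    by (simp_all add: P_def finite_zeros_laguerre card_zeros_laguerre_le)
  have sub: "f ` S \<subseteq> zeros P"
    using f by auto
  \<comment> \<open>The chosen zeros are distinct and \<open>P\<close> has at most \<open>n\<close>
    of them, so some gap among the \<open>n + 1\<close> must contain \<open>N\<close>. Disjointness
    makes it unique; the remaining \<open>n\<close> gaps then use up all zeros of
    \<open>P\<close>.\<close>
  have "card S \<le> n"
    using card_mono[OF fin_P sub] card_P inj_f by (simp add: card_image)
  then have "S \<noteq> {1..n+1}"
    by auto
  then obtain m where m: "m \<in> {1..n+1}" "N \<in> I m"
    unfolding S_def by blast
  have S_eq: "S = {1..n+1} - {m}"
    unfolding S_def using m I_disjoint by blast
  have "card S = n"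
    using m by (simp add: S_eq)
  then have zeros_P: "f ` S = zeros P"
    using card_P inj_f by (intro card_seteq[OF fin_P sub]) (simp add: card_image)
  have card_zeros_P: "card (zeros P) = degree P"
    using \<open>card S = n\<close> inj_f by (simp add: zeros_P[symmetric] card_image) (simp add: P_def)
  have P_sqfree: "rsquarefree P"
    using card_zeros_P
    by (intro rsquarefree_if_card_roots_eq_degree) (auto simp: zeros_def P_def)
  have zeros_I: "zeros P \<inter> I k = (if k = m then {} else {f k})" if "k \<in> {1..n+1}" for k
  proof -
    have "f i \<in> I k \<longleftrightarrow> i = k" if "i \<in> S" for i
      using f[OF that] I_disjoint[of "f i" i k] that \<open>k \<in> {1..n+1}\<close> by (auto simp: S_def)
    then have "f ` S \<inter> I k = f ` (S \<inter> {k})"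
      by auto
    moreover have "S \<inter> {k} = (if k = m then {} else {k})"
      using that by (auto simp: S_eq)
    ultimately show ?thesis
      by (simp add: zeros_P)
  qed
  have in_I_iff: "N \<in> I k \<longleftrightarrow> k = m" if "k \<in> {1..n+1}" for k
    using that m I_disjoint by blast
  have order_P: "order x P = 1" if "x \<in> zeros P" for x
    using that P_sqfree by (intro rsquarefree_root_order) (simp_all add: zeros_def P_def)

  have intervals: "(N \<in> I k \<and> zeros P \<inter> I k = {}) \<or>
      (N \<notin> I k \<and> (\<exists>x. zeros P \<inter> I k = {x} \<and> order x P = 1))" if "k \<in> {1..n+1}" for k
    using zeros_I[OF that] in_I_iff[OF that] order_P by (cases "k = m") auto

  \<comment> \<open>The interlacing criterion\<close>
  have card_Q: "card (zeros Q) = degree Q"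
    unfolding zeros_Q using inj_z by (simp add: card_image Q_def)
  have "only_real_simple_zeros P" "only_real_simple_zeros Q" "degree Q = degree P + 1"
    using card_Q card_zeros_P
    by (simp_all add: only_real_simple_zeros_if_card_zeros_eq_degree P_def Q_def)
  then have "interlacing P Q \<longleftrightarrow>
      (\<forall>a b. successive_zeros Q a b \<longrightarrow> (\<exists>!x. x \<in> zeros P \<and> a < x \<and> x < b))"
    unfolding interlacing_def by simp
  \<comment> \<open>The index starts at 2 because the left end 0 of the first gap is a zero of
    \<open>R\<close> but not of \<open>Q\<close>.\<close>
  also have "\<dots> \<longleftrightarrow> (\<forall>k\<in>{2..n+1}. \<exists>!x. x \<in> zeros P \<and> x \<in> I k)"
  proof -
    have "successive_zeros Q u v \<longleftrightarrow> (\<exists>k\<in>{2..n+1}. u = y (k - 1) \<and> v = y k)" for u v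
    proof
      assume "successive_zeros Q u v"
      then obtain i j where ij: "i \<in> {1..n+1}" "j \<in> {1..n+1}" "u = y i" "v = y j" "y i < y j"
        and none: "zeros Q \<inter> {y i<..<y j} = {}"
        by (auto simp: successive_zeros_def zeros_Q y_def)
      have "i < j"
        using ij y_less_iff[of i j] by auto
      moreover have "\<not> Suc i < j"
      proof
        assume "Suc i < j"
        then have "y (Suc i) \<in> zeros Q \<inter> {y i<..<y j}"
          using ij y_less[of i "Suc i"] y_less[of "Suc i" j] by (auto simp: zeros_Q y_def)
        with none show False
          by blast
      qed
      ultimately have "j = Suc i"
        by simp
      then show "\<exists>k\<in>{2..n+1}. u = y (k - 1) \<and> v = y k"
        using ij by (intro bexI[of _ j]) auto
    next
      assume "\<exists>k\<in>{2..n+1}. u = y (k - 1) \<and> v = y k"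
      then obtain k where k: "k \<in> {2..n+1}" "u = y (k - 1)" "v = y k"
        by blast
      have "zeros Q \<inter> I k = {}"
      proof (intro equals0I)
        fix x
        assume "x \<in> zeros Q \<inter> I k"
        then obtain i where "i \<in> {1..n+1}" "x = y i" "y (k - 1) < y i" "y i < y k"
          by (auto simp: zeros_Q y_def I_def)
        then have "k - 1 < i" "i < k"
          using k y_less_iff[of "k - 1" i] y_less_iff[of i k] by auto
        then show False
          by linarith
      qed
      moreover have "k - 1 \<in> {1..n+1}" "k \<in> {1..n+1}"
        using k(1) by auto
      then have "u \<in> zeros Q" "v \<in> zeros Q"
        unfolding zeros_Q using k by (auto simp: y_def)
      moreover have "u < v"
        using k by (auto intro!: y_less)
      ultimately show "successive_zeros Q u v"
        using k by (auto simp: successive_zeros_def I_def)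
    qed
    moreover have "(\<forall>u v. (\<exists>k\<in>{2..n+1}. u = y (k - 1) \<and> v = y k) \<longrightarrow> T u v) \<longleftrightarrow>
        (\<forall>k\<in>{2..n+1}. T (y (k - 1)) (y k))" for T
      by blast
    ultimately show ?thesis
      unfolding I_def greaterThanLessThan_iff by presburger
  qed
  \<comment> \<open>Only gap \<open>m\<close> lacks a zero of \<open>P\<close>, so the condition
    holds exactly when \<open>m\<close> is the one index left out.\<close>
  also have "\<dots> \<longleftrightarrow> m = 1"
  proof -
    have "(\<exists>!x. x \<in> zeros P \<and> x \<in> I k) \<longleftrightarrow> k \<noteq> m" if "k \<in> {1..n+1}" for k
      using zeros_I[OF that] by (auto simp: set_eq_iff split: if_splits)
    then have "(\<forall>k\<in>{2..n+1}. \<exists>!x. x \<in> zeros P \<and> x \<in> I k) \<longleftrightarrow> m \<notin> {2..n+1}"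
      by auto
    also have "\<dots> \<longleftrightarrow> m = 1"
      using m(1) by auto
    finally show ?thesis .
  qed
  also have "\<dots> \<longleftrightarrow> N < z 1"
    using in_I_iff[of 1] a_pos by (auto simp: I_def y_def)
  finally have interlacing_iff: "interlacing P Q \<longleftrightarrow> N < z 1" .
  have I_eq: "I k = {(if k = 1 then 0 else z (k - 1))<..<z k}" if "k \<in> {1..n+1}" for k
    using that by (simp add: I_def y_def)
  show ?thesis
    unfolding Let_def P_def[symmetric] Q_def[symmetric] N_def[symmetric]
  proof (intro conjI ballI)
    fix k
    let ?J = "{(if k = 1 then 0 else z (k - 1))<..<z k}"
    assume k: "k \<in> {1..n+1}"
    show "(N \<in> ?J \<and> zeros P \<inter> ?J = {}) \<or>
        (N \<notin> ?J \<and> (\<exists>x. zeros P \<inter> ?J = {x} \<and> order x P = 1))"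
      using intervals[OF k] unfolding I_eq[OF k] .
  qed (rule interlacing_iff)
qed

end
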